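(* Fix an integer $d>0$ and let $p=\frac{d}{d+1}$. For each $n\ge d+1$ let $\pi_n$ be chosen uniformly at random from the permutations $\pi\in S_n$ with $\mathrm{Des}(\pi)=d$. Then for every $\epsilon>0$ there is an $N$ such that \[ \left| \frac{\mathbb{P}(\pi_n(1)=k)}{(1-p)p^{k-1}} - 1 \right| < \epsilon \] for all integers $n$ and $k$ with $n\ge N$ and $1\le k\le n$.
   Context: $S_n$ is the set of permutations of $\{1,\dots,n\}$. A descent of $\pi\in S_n$ is an index $i$ with $1\le i\le n-1$ and $\pi(i)>\pi(i+1)$; $\mathrm{Des}(\pi)$ is the number of descents of $\pi$. *)

theory Defs
  imports "HOL-Probability.Probability" "HOL-Combinatorics.Permutations"
begin

definition Des :: "nat \<Rightarrow> (nat \<Rightarrow> nat) \<Rightarrow> nat" where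
  "Des n \<pi> = card {i. 1 \<le> i \<and> i \<le> n - 1 \<and> \<pi> i > \<pi> (i + 1)}"

definition perms_with_descents :: "nat \<Rightarrow> nat \<Rightarrow> (nat \<Rightarrow> nat) set" where
  "perms_with_descents n d = {\<pi>. \<pi> permutes {1..n} \<and> Des n \<pi> = d}"

text \<open>The uniform distribution below is only meaningful for \<open>n \<ge> d + 1\<close> (or \<open>n = d = 0\<close>):
  otherwise \<open>perms_with_descents n d\<close> is empty and \<open>pmf_of_set\<close> is unspecified.\<close>

definition random_perm :: "nat \<Rightarrow> nat \<Rightarrow> (nat \<Rightarrow> nat) pmf" where
  "random_perm n d = pmf_of_set (perms_with_descents n d)"

end

theory Submission imports Defs "HOL-Real_Asymp.Real_Asymp" begin

text \<open>
  Let \<open>A(n,d,k)\<close> count the permutations of \<open>{1..n}\<close> with \<open>d\<close> descents and first entry \<open>k\<close>.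
  Deleting the first entry gives
  \<open>A(n+1,d,k) = (\<Sum>j=k..n. A(n,d,j)) + (\<Sum>j<k. A(n,d-1,j))\<close>, and induction on \<open>n\<close> yields
  \<open>A(n,d,k) = (\<Sum>i\<le>d. (-1)^i (n choose i) (d-i)^(k-1) (d-i+1)^(n-k))\<close>.
  The term \<open>i = 0\<close> is \<open>d^(k-1) (d+1)^(n-k)\<close>, and the others are smaller by a factor of at most
  \<open>n^d p^(n-1)\<close>, which tends to \<open>0\<close> and does not depend on \<open>k\<close>. Summing the main terms over \<open>k\<close>
  gives \<open>(d+1)^n - d^n \<sim> (d+1)^n\<close>, so the quotient is asymptotic to
  \<open>d^(k-1) / (d+1)^k = (1-p) p^(k-1)\<close> uniformly in \<open>k\<close>.
\<close>

section \<open>Deleting and prepending a first entry\<close>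

definition perms_starting :: "nat \<Rightarrow> nat \<Rightarrow> nat \<Rightarrow> (nat \<Rightarrow> nat) set" where
  "perms_starting n d k = {\<pi>. \<pi> permutes {1..n} \<and> Des n \<pi> = d \<and> \<pi> 1 = k}"

text \<open>The increasing enumeration of the naturals other than \<open>k\<close>; relabelling
  entries by it preserves every comparison, hence every descent.\<close>

definition skip :: "nat \<Rightarrow> nat \<Rightarrow> nat" where
  "skip k j = (if j < k then j else Suc j)"

text \<open>Inverse of deleting the first entry and standardizing the rest. The first case is there
  because \<open>permutes\<close> demands the identity outside \<open>{1..Suc n}\<close>.\<close>

definition prepend :: "nat \<Rightarrow> nat \<Rightarrow> (nat \<Rightarrow> nat) \<Rightarrow> nat \<Rightarrow> nat" where
  "prepend n k \<sigma> i = (if i = 0 \<or> i > Suc n then i else if i = 1 then k else skip k (\<sigma> (i - 1)))"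

lemma skip_less_skip_iff [simp]: "skip k i < skip k j \<longleftrightarrow> i < j"
  by (auto simp: skip_def)

lemma skip_eq_skip_iff [simp]: "skip k i = skip k j \<longleftrightarrow> i = j"
  by (auto simp: skip_def)

lemma skip_neq [simp]: "skip k i \<noteq> k"
  by (auto simp: skip_def)

lemma skip_less_iff [simp]: "skip k i < k \<longleftrightarrow> i < k"
  by (auto simp: skip_def)

lemma finite_permutes_Collect: "finite {\<pi>. \<pi> permutes {1..n::nat} \<and> P \<pi>}"
  by (rule finite_subset[OF _ finite_permutations[of "{1..n}"]]) auto

text \<open>By finiteness an injective self-map is onto, so surjectivity need not be checked for
  \<open>prepend n k \<sigma>\<close> or for the shortened permutation.\<close>

lemma inj_on_permutes:
  assumes "finite S" "inj_on f S" "f ` S \<subseteq> S" "\<And>x. x \<notin> S \<Longrightarrow> f x = x"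
  shows "f permutes S"
  using assms by (intro bij_imp_permutes) (auto simp: bij_betw_def endo_inj_surj)

lemma prepend_permutes:
  assumes "\<sigma> permutes {1..n}" "k \<in> {1..Suc n}"
  shows "prepend n k \<sigma> permutes {1..Suc n}"
proof (rule inj_on_permutes)
  have inj: "\<sigma> i = \<sigma> j \<longleftrightarrow> i = j" for i j
    using permutes_inj[OF assms(1)] by (auto simp: inj_def)
  show "inj_on (prepend n k \<sigma>) {1..Suc n}"
    by (auto simp: inj_on_def prepend_def inj skip_neq[symmetric] split: if_splits)
  show "prepend n k \<sigma> ` {1..Suc n} \<subseteq> {1..Suc n}"
  proof safe
    fix i assume i: "i \<in> {1..Suc n}"
    show "prepend n k \<sigma> i \<in> {1..Suc n}"
    proof (cases "i = 1")
      case False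
      hence "\<sigma> (i - 1) \<in> {1..n}"
        using i by (subst permutes_in_image[OF assms(1)]) auto
      thus ?thesis using i False by (auto simp: prepend_def skip_def)
    qed (use assms(2) in \<open>simp add: prepend_def\<close>)
  qed
qed (auto simp: prepend_def)

text \<open>Old descents move one place to the right and survive the monotone relabelling. The only
  new comparison is \<open>k\<close> against \<open>skip k (\<sigma> 1)\<close>, which is a descent
  iff \<open>\<sigma> 1 < k\<close>.\<close>

lemma Des_prepend:
  assumes "n \<ge> 1"
  shows "Des (Suc n) (prepend n k \<sigma>) = Des n \<sigma> + of_bool (\<sigma> 1 < k)"
proof -
  define D where "D = {i. 1 \<le> i \<and> i \<le> n - 1 \<and> \<sigma> i > \<sigma> (i + 1)}"
  define E where "E = (if \<sigma> 1 < k then {1::nat} else {})"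
  have "{i. 1 \<le> i \<and> i \<le> Suc n - 1 \<and> prepend n k \<sigma> i > prepend n k \<sigma> (i + 1)} = Suc ` D \<union> E"
    (is "?L = _")
  proof (rule set_eqI)
    fix i
    consider "i = 0" | "i = 1" | j where "i = Suc j" "j \<ge> 1"
      by (metis One_nat_def Suc_le_eq not0_implies_Suc not_gr0)
    thus "i \<in> ?L \<longleftrightarrow> i \<in> Suc ` D \<union> E"
      by cases (use assms in \<open>auto simp: prepend_def D_def E_def\<close>)
  qed
  moreover have "finite D"
    by (rule finite_subset[of _ "{..n}"]) (auto simp: D_def)
  moreover have "Suc ` D \<inter> E = {}"
    by (auto simp: D_def E_def)
  ultimately have "Des (Suc n) (prepend n k \<sigma>) = card D + card E"
    by (simp add: Des_def card_Un_disjoint card_image E_def)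
  thus ?thesis
    by (simp add: Des_def D_def E_def)
qed

text \<open>\<open>prepend\<close> discards the values of \<open>\<sigma>\<close> outside
  \<open>{1..n}\<close>; there, permutations of \<open>{1..n}\<close> agree because they are the
  identity.\<close>

lemma inj_on_prepend: "inj_on (prepend n k) {\<sigma>. \<sigma> permutes {1..n}}"
proof (rule inj_onI, rule ext)
  fix \<sigma> \<tau> i assume *: "\<sigma> \<in> {\<sigma>. \<sigma> permutes {1..n}}" "\<tau> \<in> {\<sigma>. \<sigma> permutes {1..n}}"
    and eq: "prepend n k \<sigma> = prepend n k \<tau>"
  show "\<sigma> i = \<tau> i"
  proof (cases "i \<in> {1..n}")
    case True
    thus ?thesis
      using fun_cong[OF eq, of "Suc i"] by (auto simp: prepend_def)
  next
    case False
    thus ?thesis using * by (simp add: permutes_def)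
  qed
qed

text \<open>Surjectivity of prepending: drop the first entry and close the gap at
  \<open>\<pi> 1\<close> by \<open>u\<close>. Applying \<open>skip (\<pi> 1)\<close> undoes
  \<open>u\<close> except at the value \<open>\<pi> 1\<close>, which no later entry takes.\<close>

lemma permutes_obtain_prepend:
  assumes "\<pi> permutes {1..Suc n}"
  obtains \<sigma> where "\<sigma> permutes {1..n}" "\<pi> = prepend n (\<pi> 1) \<sigma>"
proof
  define u where "u j = (if j < \<pi> 1 then j else j - 1)" for j
  define \<sigma> where "\<sigma> i = (if i \<in> {1..n} then u (\<pi> (Suc i)) else i)" for i
  have inj: "\<pi> i = \<pi> j \<longleftrightarrow> i = j" for i j
    using permutes_inj[OF assms] by (auto simp: inj_def)
  have ran: "\<pi> i \<in> {1..Suc n}" if "i \<in> {1..Suc n}" for i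
    using permutes_in_image[OF assms] that by blast
  have skip_u: "skip (\<pi> 1) (u j) = j" if "j \<noteq> \<pi> 1" for j
    using that by (auto simp: u_def skip_def)
  have ne: "\<pi> (Suc i) \<noteq> \<pi> 1" if "i \<in> {1..n}" for i
    using that by (simp add: inj)
  show "\<sigma> permutes {1..n}"
  proof (rule inj_on_permutes)
    show "inj_on \<sigma> {1..n}"
    proof (rule inj_onI)
      fix i j assume ij: "i \<in> {1..n}" "j \<in> {1..n}" and "\<sigma> i = \<sigma> j"
      hence "skip (\<pi> 1) (u (\<pi> (Suc i))) = skip (\<pi> 1) (u (\<pi> (Suc j)))"
        by (simp add: \<sigma>_def)
      hence "\<pi> (Suc i) = \<pi> (Suc j)"
        by (simp only: skip_u[OF ne] ij)
      thus "i = j" by (simp add: inj)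
    qed
    show "\<sigma> ` {1..n} \<subseteq> {1..n}"
    proof safe
      fix i assume i: "i \<in> {1..n}"
      have "\<pi> (Suc i) \<in> {1..Suc n}" "\<pi> 1 \<in> {1..Suc n}"
        by (rule ran, use i in simp)+
      thus "\<sigma> i \<in> {1..n}" using i ne[OF i] by (auto simp: \<sigma>_def u_def)
    qed
  qed (auto simp: \<sigma>_def)
  show "\<pi> = prepend n (\<pi> 1) \<sigma>"
  proof
    fix i
    consider "i \<notin> {1..Suc n}" | "i = 1" | j where "i = Suc j" "j \<in> {1..n}"
      by (cases i) force+
    thus "\<pi> i = prepend n (\<pi> 1) \<sigma> i"
    proof cases
      case 1
      thus ?thesis using assms by (auto simp: prepend_def permutes_def)
    next
      case 2
      thus ?thesis by (auto simp: prepend_def)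
    next
      case 3
      thus ?thesis using skip_u[OF ne[of j]] by (simp add: prepend_def \<sigma>_def)
    qed
  qed
qed

section \<open>Recurrence for the counts by descents and first entry\<close>

lemma perms_starting_Suc_eq_image:
  assumes "n \<ge> 1" "k \<in> {1..Suc n}"
  shows "perms_starting (Suc n) d k =
    prepend n k ` {\<sigma>. \<sigma> permutes {1..n} \<and> Des n \<sigma> + of_bool (\<sigma> 1 < k) = d}"
proof safe
  fix \<pi> assume \<pi>: "\<pi> \<in> perms_starting (Suc n) d k"
  then obtain \<sigma> where "\<sigma> permutes {1..n}" "\<pi> = prepend n (\<pi> 1) \<sigma>"
    using permutes_obtain_prepend by (auto simp: perms_starting_def)
  moreover from this have "Des n \<sigma> + of_bool (\<sigma> 1 < k) = d"
    using \<pi> Des_prepend[OF assms(1), of k \<sigma>] by (simp add: perms_starting_def)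
  ultimately show "\<pi> \<in> prepend n k ` {\<sigma>. \<sigma> permutes {1..n} \<and> Des n \<sigma> + of_bool (\<sigma> 1 < k) = d}"
    using \<pi> by (auto simp: perms_starting_def)
next
  fix \<sigma> assume "\<sigma> permutes {1..n}"
  thus "prepend n k \<sigma> \<in> perms_starting (Suc n) (Des n \<sigma> + of_bool (\<sigma> 1 < k)) k"
    unfolding perms_starting_def
    using prepend_permutes[OF _ assms(2)] Des_prepend[OF assms(1)] by (simp add: prepend_def[of _ _ _ "Suc 0"])
qed

text \<open>Serves twice: to split the recurrence, and to write the total number of permutations
  with \<open>d\<close> descents as a sum over first entries.\<close>

lemma card_permutes_by_first:
  fixes n :: nat
  assumes "n \<ge> 1"
  shows "card {\<sigma>. \<sigma> permutes {1..n} \<and> P \<sigma>} =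
    (\<Sum>j\<in>{1..n}. card {\<sigma>. \<sigma> permutes {1..n} \<and> P \<sigma> \<and> \<sigma> 1 = j})"
proof -
  have "\<sigma> 1 \<in> {1..n}" if "\<sigma> permutes {1..n}" for \<sigma>
    using assms by (subst permutes_in_image[OF that]) simp
  hence "{\<sigma>. \<sigma> permutes {1..n} \<and> P \<sigma>} =
      (\<Union>j\<in>{1..n}. {\<sigma>. \<sigma> permutes {1..n} \<and> P \<sigma> \<and> \<sigma> 1 = j})"
    by blast
  thus ?thesis
    by (simp only:) (subst card_UN_disjoint, auto simp: finite_permutes_Collect[simplified])
qed

text \<open>Here \<open>j\<close> is the first entry of the shortened permutation; stepping from
  \<open>k\<close> down to \<open>j < k\<close> uses up one descent. The case \<open>d = 0\<close>
  is separate because \<open>d - 1\<close> truncates to 0, whereas the contribution must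
  vanish.\<close>

lemma card_perms_starting_Suc:
  assumes "n \<ge> 1" "k \<in> {1..Suc n}"
  shows "card (perms_starting (Suc n) d k) =
    (\<Sum>j=k..n. card (perms_starting n d j)) +
    (if d = 0 then 0 else \<Sum>j=1..<k. card (perms_starting n (d - 1) j))"
proof -
  define C where
    "C j = card {\<sigma>. \<sigma> permutes {1..n} \<and> Des n \<sigma> + of_bool (\<sigma> 1 < k) = d \<and> \<sigma> 1 = j}" for j
  \<comment> \<open>With \<open>\<sigma> 1\<close> replaced by \<open>j\<close>, the descent
    condition is the same for all permutations counted by \<open>C j\<close>.\<close>
  have C_eq: "C j = card {\<sigma>. \<sigma> permutes {1..n} \<and> Des n \<sigma> + of_bool (j < k) = d \<and> \<sigma> 1 = j}" for j
    unfolding C_def by (intro arg_cong[of _ _ card] Collect_cong) metis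
  have "card (perms_starting (Suc n) d k) =
      card {\<sigma>. \<sigma> permutes {1..n} \<and> Des n \<sigma> + of_bool (\<sigma> 1 < k) = d}"
    unfolding perms_starting_Suc_eq_image[OF assms]
    by (intro card_image inj_on_subset[OF inj_on_prepend]) auto
  also have "\<dots> = (\<Sum>j\<in>{1..n}. C j)"
    unfolding C_def by (rule card_permutes_by_first[OF assms(1)])
  also have "{1..n} = {k..n} \<union> {1..<k}"
    using assms by auto
  also have "sum C \<dots> = (\<Sum>j=k..n. C j) + (\<Sum>j=1..<k. C j)"
    by (rule sum.union_disjoint) auto
  finally have "card (perms_starting (Suc n) d k) = (\<Sum>j=k..n. C j) + (\<Sum>j=1..<k. C j)" .
  moreover have "C j = card (perms_starting n d j)" if "k \<le> j" for j
    using that by (simp add: C_eq perms_starting_def)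
  moreover have "C j = (if d = 0 then 0 else card (perms_starting n (d - 1) j))" if "j < k" for j
    using that by (cases d) (simp_all add: C_eq perms_starting_def)
  ultimately show ?thesis by simp
qed

section \<open>The explicit alternating formula\<close>

lemma sum_power_mult_Suc_power:
  fixes x :: real
  assumes "1 \<le> a" "a \<le> b" "b \<le> Suc n"
  shows "(\<Sum>j=a..<b. x ^ (j - 1) * (x + 1) ^ (n - j)) =
    x ^ (a - 1) * (x + 1) ^ (Suc n - a) - x ^ (b - 1) * (x + 1) ^ (Suc n - b)"
  using assms(2,3)
proof (induction b rule: dec_induct)
  \<comment> \<open>The sum telescopes: with
    \<open>G j = x ^ (j - 1) * (x + 1) ^ (Suc n - j)\<close>, the summand is
    \<open>G j - G (j + 1)\<close> since \<open>(x + 1) - x = 1\<close>. Writing \<open>m\<close> as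
    a successor and \<open>n\<close> as \<open>m + r\<close> removes the truncated
    subtractions.\<close>
  case (step m)
  then obtain r m' where "n = m + r" "m = Suc m'"
    using assms(1) by (metis Suc_le_D le_Suc_ex le_trans Suc_le_mono One_nat_def)
  with step show ?case by (simp add: algebra_simps Suc_diff_le)
qed simp

text \<open>Under the recurrence both inner sums telescope, their end terms cancel against each
  other, and Pascal's rule merges the rest. For \<open>k = 1\<close> the term \<open>i = d\<close>
  relies on \<open>0 ^ 0 = 1\<close>.\<close>

theorem card_perms_starting:
  assumes "n \<ge> 1" "k \<in> {1..n}"
  shows "real (card (perms_starting n d k)) =
    (\<Sum>i\<le>d. (-1) ^ i * real (n choose i) * real (d - i) ^ (k - 1) * (real (d - i) + 1) ^ (n - k))"
  using assms
proof (induction n arbitrary: d k rule: nat_induct_at_least)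
  case base
  have "perms_starting 1 d 1 = (if d = 0 then {id} else {})"
    by (auto simp: perms_starting_def Des_def permutes_sing)
  moreover have "(\<Sum>i\<le>d. (-1) ^ i * real (Suc 0 choose i)) = (if d = 0 then 1 else 0)"
    by (induction d) (auto simp: binomial_eq_0)
  ultimately show ?case using base by simp
next
  case (Suc n)
  define c where "c i = (-1) ^ i * real (n choose i)" for i
  \<comment> \<open>Both telescoped sums have \<open>F\<close> as their boundary term at
    \<open>k\<close>, and \<open>F\<close> is also the power factor of the formula for
    \<open>Suc n\<close>, so only coefficients remain to be compared.\<close>
  define F where "F x = x ^ (k - 1) * (x + 1) ^ (Suc n - k)" for x :: real
  have k: "k \<in> {1..Suc n}" using Suc.prems .
  have swap: "(\<Sum>j\<in>J. real (card (perms_starting n e j))) =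
      (\<Sum>i\<le>e. c i * (\<Sum>j\<in>J. real (e - i) ^ (j - 1) * (real (e - i) + 1) ^ (n - j)))"
    if "J \<subseteq> {1..n}" for J e
  proof -
    have "(\<Sum>j\<in>J. real (card (perms_starting n e j))) =
        (\<Sum>j\<in>J. \<Sum>i\<le>e. c i * (real (e - i) ^ (j - 1) * (real (e - i) + 1) ^ (n - j)))"
      using that by (intro sum.cong refl) (subst Suc.IH, auto simp: c_def mult.assoc)
    also have "\<dots> = (\<Sum>i\<le>e. \<Sum>j\<in>J. c i * (real (e - i) ^ (j - 1) * (real (e - i) + 1) ^ (n - j)))"
      by (rule sum.swap)
    finally show ?thesis by (simp add: sum_distrib_left)
  qed
  have upper: "(\<Sum>j=k..n. real (card (perms_starting n d j))) =
      (\<Sum>i\<le>d. c i * F (real (d - i))) - (\<Sum>i\<le>d. c i * real (d - i) ^ n)"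
  proof -
    have "(\<Sum>j=k..n. x ^ (j - 1) * (x + 1) ^ (n - j)) = F x - x ^ n" for x :: real
      using sum_power_mult_Suc_power[of k "Suc n" n x] k
      by (simp add: F_def atLeastLessThanSuc_atLeastAtMost)
    thus ?thesis
      using k by (subst swap) (auto simp: right_diff_distrib sum_subtractf)
  qed
  have lower: "(\<Sum>j=1..<k. real (card (perms_starting n e j))) =
      (\<Sum>i\<le>e. c i * (real (e - i) + 1) ^ n) - (\<Sum>i\<le>e. c i * F (real (e - i)))" for e
  proof -
    have "(\<Sum>j=1..<k. x ^ (j - 1) * (x + 1) ^ (n - j)) = (x + 1) ^ n - F x" for x :: real
      using sum_power_mult_Suc_power[of 1 k n x] k by (simp add: F_def)
    thus ?thesis
      using k by (subst swap) (auto simp: right_diff_distrib sum_subtractf)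
  qed
  have "real (card (perms_starting (Suc n) d k)) =
      (\<Sum>i\<le>d. (-1) ^ i * real (Suc n choose i) * F (real (d - i)))"
  proof (cases d)
    case 0
    thus ?thesis
      using Suc.hyps upper by (simp add: card_perms_starting_Suc[OF Suc.hyps k] c_def)
  next
    case (Suc e)
    \<comment> \<open>The end terms at the extremes of the two ranges agree: the extra summand
      \<open>i = d\<close> is \<open>0 ^ n\<close>, which vanishes as
      \<open>n \<ge> 1\<close>.\<close>
    have "(\<Sum>i\<le>d. c i * real (d - i) ^ n) = (\<Sum>i\<le>e. c i * (real (e - i) + 1) ^ n)"
      using Suc \<open>n \<ge> 1\<close> by (auto simp: Suc_diff_le algebra_simps power_0_left intro!: sum.cong)
    hence "real (card (perms_starting (Suc n) d k)) =
        (\<Sum>i\<le>d. c i * F (real (d - i))) - (\<Sum>i\<le>e. c i * F (real (e - i)))"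
      using Suc upper lower[of e] by (simp add: card_perms_starting_Suc[OF Suc.hyps k])
    \<comment> \<open>The index shift aligns the arguments of \<open>F\<close>; the coefficient
      \<open>c (Suc i) - c i\<close> is then Pascal's rule up to sign.\<close>
    also have "(\<Sum>i\<le>d. c i * F (real (d - i))) =
        F (real d) + (\<Sum>i\<le>e. c (Suc i) * F (real (e - i)))"
      unfolding Suc by (subst sum.atMost_Suc_shift) (simp add: c_def)
    also have "\<dots> - (\<Sum>i\<le>e. c i * F (real (e - i))) =
        F (real d) + (\<Sum>i\<le>e. (-1) ^ Suc i * real (Suc n choose Suc i) * F (real (e - i)))"
      by (simp add: c_def algebra_simps flip: sum_subtractf sum_negf sum.distrib)
    also have "\<dots> = (\<Sum>i\<le>d. (-1) ^ i * real (Suc n choose i) * F (real (d - i)))"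
      unfolding Suc by (subst sum.atMost_Suc_shift) simp
    finally show ?thesis .
  qed
  thus ?case by (simp add: F_def mult.assoc)
qed

section \<open>Relative error of the main term, uniform in the first entry\<close>

lemma card_perms_starting_approx:
  fixes d n k :: nat
  defines "p \<equiv> real d / (real d + 1)"
  defines "T \<equiv> real d ^ (k - 1) * (real d + 1) ^ (n - k)"
  assumes "d > 0" "k \<in> {1..n}"
  shows "\<bar>real (card (perms_starting n d k)) - T\<bar> \<le> real d * real n ^ d * p ^ (n - 1) * T"
proof -
  define t where
    "t i = (-1) ^ i * real (n choose i) * real (d - i) ^ (k - 1) * (real (d - i) + 1) ^ (n - k)" for i
  have n: "n \<ge> 1" and nk: "n - 1 = (k - 1) + (n - k)" using assms(4) by auto
  \<comment> \<open>For \<open>i \<ge> 1\<close> the bases satisfy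
    \<open>d - i \<le> d - 1 \<le> p * d\<close> and \<open>d - i + 1 \<le> d = p * (d + 1)\<close>.
    So each of the \<open>(k - 1) + (n - k) = n - 1\<close> factors of \<open>T\<close> shrinks by
    at least \<open>p\<close>, whatever \<open>k\<close> is.\<close>
  have p: "p \<ge> 0" "real d - 1 \<le> p * real d" "real d = p * (real d + 1)"
    using assms(3) by (auto simp: p_def field_simps)
  have bound: "\<bar>t i\<bar> \<le> real n ^ d * p ^ (n - 1) * T" if "i \<in> {1..d}" for i
  proof -
    have "n choose i \<le> n ^ d"
    proof (cases "i \<le> n")
      case True
      have "n choose i \<le> n ^ i" using True by (rule binomial_le_pow)
      also have "\<dots> \<le> n ^ d" using that n by (intro power_increasing) auto
      finally show ?thesis .
    qed (simp add: binomial_eq_0)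
    hence "real (n choose i) \<le> real n ^ d"
      by (metis of_nat_le_iff of_nat_power)
    moreover have "real (d - i) ^ (k - 1) \<le> (p * real d) ^ (k - 1)"
      using that p by (intro power_mono) auto
    moreover have "(real (d - i) + 1) ^ (n - k) \<le> (p * (real d + 1)) ^ (n - k)"
      using that p(3) by (intro power_mono) auto
    ultimately have "\<bar>t i\<bar> \<le> real n ^ d * (p * real d) ^ (k - 1) * (p * (real d + 1)) ^ (n - k)"
      unfolding t_def abs_mult using p(1) by (intro mult_mono) (auto simp: power_abs)
    also have "\<dots> = real n ^ d * p ^ (n - 1) * T"
      unfolding nk by (simp add: T_def power_mult_distrib power_add)
    finally show ?thesis .
  qed
  have "real (card (perms_starting n d k)) = (\<Sum>i\<le>d. t i)"
    unfolding t_def using n assms(4) by (rule card_perms_starting)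
  also have "\<dots> = T + (\<Sum>i=1..d. t i)"
    by (simp add: t_def T_def atMost_atLeast0 sum.atLeast_Suc_atMost)
  finally have "\<bar>real (card (perms_starting n d k)) - T\<bar> = \<bar>\<Sum>i=1..d. t i\<bar>" by simp
  also have "\<dots> \<le> (\<Sum>i=1..d. \<bar>t i\<bar>)" by (rule sum_abs)
  also have "\<dots> \<le> real (card {1..d}) * (real n ^ d * p ^ (n - 1) * T)"
    using bound by (rule sum_bounded_above)
  finally show ?thesis by (simp add: mult.assoc)
qed

section \<open>From counts to probabilities and the uniform limit\<close>

lemma prob_random_perm_first:
  assumes "n \<ge> 1" "perms_with_descents n d \<noteq> {}"
  shows "measure_pmf.prob (random_perm n d) {\<pi>. \<pi> 1 = k} =
    real (card (perms_starting n d k)) / (\<Sum>j=1..n. real (card (perms_starting n d j)))"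
proof -
  have fin: "finite (perms_with_descents n d)"
    unfolding perms_with_descents_def by (rule finite_permutes_Collect)
  have "perms_with_descents n d \<inter> {\<pi>. \<pi> 1 = k} = perms_starting n d k"
    by (auto simp: perms_with_descents_def perms_starting_def)
  moreover have "card (perms_with_descents n d) = (\<Sum>j=1..n. card (perms_starting n d j))"
    using card_permutes_by_first[OF assms(1), of "\<lambda>\<pi>. Des n \<pi> = d"]
    by (simp add: perms_with_descents_def perms_starting_def)
  ultimately show ?thesis
    using fin assms(2) by (simp add: random_perm_def measure_pmf_of_set)
qed

theorem theorem8:
  fixes d :: nat and p :: real
  assumes "d > 0" and "p = real d / (real d + 1)"
  shows "\<forall>\<epsilon>::real. \<epsilon> > 0 \<longrightarrow>
    (\<exists>N::nat. \<forall>n k::nat. n \<ge> d + 1 \<longrightarrow> n \<ge> N \<longrightarrow> 1 \<le> k \<longrightarrow> k \<le> n \<longrightarrow>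
      \<bar>measure_pmf.prob (random_perm n d) {\<pi>. \<pi> 1 = k} / ((1 - p) * p ^ (k - 1)) - 1\<bar> < \<epsilon>)"
proof (intro allI impI)
  fix \<epsilon> :: real assume "\<epsilon> > 0"
  \<comment> \<open>The relative error bound from \<open>card_perms_starting_approx\<close>; it is
    free of \<open>k\<close>, so one \<open>N\<close> serves all \<open>k\<close>.\<close>
  define \<delta> where "\<delta> n = real d * real n ^ d * p ^ (n - 1)" for n
  have p: "0 < p" "p < 1" unfolding assms(2) using assms(1) by (simp_all add: field_simps)
  have "(\<lambda>n. real d * real n ^ d * p ^ (n - 1)) \<longlonglongrightarrow> 0"
    using p by real_asymp
  hence \<delta>: "\<delta> \<longlonglongrightarrow> 0" by (simp add: \<delta>_def[abs_def])
  have pn: "(\<lambda>n. p ^ n) \<longlonglongrightarrow> 0" using p by (intro LIMSEQ_power_zero) auto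
  \<comment> \<open>The ratio in question will be \<open>(a k / T k) / (S / M)\<close>, with
    numerator between \<open>1 - \<delta> n\<close> and \<open>1 + \<delta> n\<close> and
    denominator between \<open>(1 - \<delta> n) * (1 - p ^ n)\<close> and
    \<open>1 + \<delta> n\<close>. The extreme quotients both tend to 1.\<close>
  have "(\<lambda>n. (1 - \<delta> n) / (1 + \<delta> n)) \<longlonglongrightarrow> (1 - 0) / (1 + 0)"
    by (intro tendsto_intros \<delta>) auto
  hence lo: "\<forall>\<^sub>F n in sequentially. (1 - \<delta> n) / (1 + \<delta> n) > 1 - \<epsilon>"
    using \<open>\<epsilon> > 0\<close> by (intro order_tendstoD) auto
  have "(\<lambda>n. (1 + \<delta> n) / ((1 - \<delta> n) * (1 - p ^ n))) \<longlonglongrightarrow> (1 + 0) / ((1 - 0) * (1 - 0))"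
    by (intro tendsto_intros \<delta> pn) auto
  hence hi: "\<forall>\<^sub>F n in sequentially. (1 + \<delta> n) / ((1 - \<delta> n) * (1 - p ^ n)) < 1 + \<epsilon>"
    using \<open>\<epsilon> > 0\<close> by (intro order_tendstoD) auto
  have "\<forall>\<^sub>F n in sequentially. \<delta> n < 1"
    using \<delta> by (intro order_tendstoD) auto
  with lo hi have "\<forall>\<^sub>F n in sequentially. (1 - \<delta> n) / (1 + \<delta> n) > 1 - \<epsilon> \<and>
      (1 + \<delta> n) / ((1 - \<delta> n) * (1 - p ^ n)) < 1 + \<epsilon> \<and> \<delta> n < 1"
    by eventually_elim simp
  then obtain N where N: "\<And>n. n \<ge> N \<Longrightarrow> (1 - \<delta> n) / (1 + \<delta> n) > 1 - \<epsilon> \<and>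
      (1 + \<delta> n) / ((1 - \<delta> n) * (1 - p ^ n)) < 1 + \<epsilon> \<and> \<delta> n < 1"
    by (auto simp: eventually_sequentially)
  show "\<exists>N::nat. \<forall>n k::nat. n \<ge> d + 1 \<longrightarrow> n \<ge> N \<longrightarrow> 1 \<le> k \<longrightarrow> k \<le> n \<longrightarrow>
      \<bar>measure_pmf.prob (random_perm n d) {\<pi>. \<pi> 1 = k} / ((1 - p) * p ^ (k - 1)) - 1\<bar> < \<epsilon>"
  proof (intro exI[of _ N] allI impI)
    fix n k assume n: "n \<ge> d + 1" "n \<ge> N" and k: "1 \<le> k" "k \<le> n"
    define a where "a j = real (card (perms_starting n d j))" for j
    define T where "T j = real d ^ (j - 1) * (real d + 1) ^ (n - j)" for j
    define S where "S = (\<Sum>j=1..n. a j)"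
    define M where "M = (real d + 1) ^ n"
    note N' = N[OF n(2)]
    have \<delta>0: "\<delta> n \<ge> 0" using p by (simp add: \<delta>_def)
    have T_pos: "T j > 0" for j using assms by (simp add: T_def)
    have M_pos: "M > 0" by (simp add: M_def add_pos_nonneg)
    have pn1: "0 < 1 - p ^ n" using p n(1) by (simp add: power_less_one_iff)
    have a: "(1 - \<delta> n) * T j \<le> a j" "a j \<le> (1 + \<delta> n) * T j" if "j \<in> {1..n}" for j
      using card_perms_starting_approx[OF assms(1) that]
      by (simp_all add: a_def T_def \<delta>_def assms(2) abs_le_iff algebra_simps)
    \<comment> \<open>The main terms telescope over the full range to \<open>M\<close> minus
      \<open>d ^ n\<close>, a defect of relative size \<open>p ^ n\<close>.\<close>
    have "(\<Sum>j=1..n. T j) = (\<Sum>j=1..<Suc n. T j)"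
      by (simp add: atLeastLessThanSuc_atLeastAtMost)
    also have "\<dots> = M - real d ^ n"
      unfolding T_def M_def by (subst sum_power_mult_Suc_power) auto
    also have "real d ^ n = M * p ^ n"
      by (simp add: M_def assms(2) flip: power_mult_distrib)
    finally have sumT: "(\<Sum>j=1..n. T j) = M * (1 - p ^ n)"
      by (simp add: algebra_simps)
    have "(1 - \<delta> n) * (M * (1 - p ^ n)) \<le> S"
      unfolding S_def sumT[symmetric] sum_distrib_left by (intro sum_mono a)
    hence S_lo: "M * ((1 - \<delta> n) * (1 - p ^ n)) \<le> S" by (simp add: mult_ac)
    have "S \<le> (1 + \<delta> n) * (M * (1 - p ^ n))"
      unfolding S_def sumT[symmetric] sum_distrib_left by (intro sum_mono a)
    also have "\<dots> \<le> (1 + \<delta> n) * (M * 1)"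
      using p M_pos \<delta>0 by (intro mult_left_mono) auto
    finally have S_hi: "S \<le> M * (1 + \<delta> n)" by (simp add: mult_ac)
    have S_pos: "S > 0"
      using S_lo N' M_pos pn1 by (smt (verit) mult_pos_pos)
    \<comment> \<open>\<open>pmf_of_set\<close> is specified only on nonempty sets. Positivity of
      \<open>S\<close>, which rests on \<open>\<delta> n < 1\<close>, gives this without exhibiting
      a permutation.\<close>
    have nonempty: "perms_with_descents n d \<noteq> {}"
    proof
      assume "perms_with_descents n d = {}"
      hence "perms_starting n d j = {}" for j
        by (auto simp: perms_with_descents_def perms_starting_def)
      thus False using S_pos by (simp add: S_def a_def)
    qed
    define b where "b = real d + 1"
    have "b > 0" by (simp add: b_def)
    \<comment> \<open>Of the \<open>n\<close> factors \<open>b\<close> in \<open>M\<close>,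
      \<open>k - 1\<close> turn \<open>d ^ (k - 1)\<close> into \<open>p ^ (k - 1)\<close>,
      \<open>n - k\<close> cancel against \<open>T k\<close>, and the last one supplies
      \<open>1 - p\<close>.\<close>
    have "n = Suc (k - 1) + (n - k)" using k by simp
    hence "b ^ n = b * b ^ (k - 1) * b ^ (n - k)"
      by (metis power_Suc power_add)
    moreover have "1 - p = 1 / b" by (simp add: assms(2) b_def field_simps)
    ultimately have q: "(1 - p) * p ^ (k - 1) = T k / M"
      using \<open>b > 0\<close> unfolding T_def M_def assms(2) b_def[symmetric]
      by (simp add: power_divide)
    have "measure_pmf.prob (random_perm n d) {\<pi>. \<pi> 1 = k} = a k / S"
      using prob_random_perm_first[OF _ nonempty] n(1) by (simp add: a_def S_def)
    hence eq: "measure_pmf.prob (random_perm n d) {\<pi>. \<pi> 1 = k} / ((1 - p) * p ^ (k - 1)) =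
        (a k / T k) / (S / M)"
      unfolding q by simp
    have ak: "1 - \<delta> n \<le> a k / T k" "a k / T k \<le> 1 + \<delta> n"
      using a[of k] k T_pos[of k] by (simp_all add: pos_le_divide_eq pos_divide_le_eq)
    have SM: "(1 - \<delta> n) * (1 - p ^ n) \<le> S / M" "S / M \<le> 1 + \<delta> n"
      using S_lo S_hi M_pos by (simp_all add: pos_le_divide_eq pos_divide_le_eq mult.commute)
    have "(1 - \<delta> n) / (1 + \<delta> n) \<le> (a k / T k) / (S / M)"
      using ak SM N' S_pos M_pos by (intro frac_le) auto
    moreover have "(a k / T k) / (S / M) \<le> (1 + \<delta> n) / ((1 - \<delta> n) * (1 - p ^ n))"
      using ak SM N' pn1 \<delta>0 by (intro frac_le) auto
    ultimately show "\<bar>measure_pmf.prob (random_perm n d) {\<pi>. \<pi> 1 = k} / ((1 - p) * p ^ (k - 1)) - 1\<bar> < \<epsilon>"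
      using N' unfolding eq by (simp add: abs_less_iff)
  qed
qed

end
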